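(* Let $X$ be a random vector in $\mathbb R^d$. Assume that $\mathbb E[XX^\top]=I_d$ and that there are constants $C\ge1$ and $\alpha\in(0,1]$ such that, for every $\theta\in S^{d-1}$ and $t>0$, $$\mathbb P\big(|\langle\theta,X\rangle|\le t\big)\le(Ct)^\alpha .$$ If $n\ge6d/\alpha$, then for every $t\in(0,1)$, $$\mathbb P\big(\lambda_{\min}(\widehat\Sigma_n)\le t\big)\le(C't)^{\alpha n/6},$$ where $C'=3C^4e^{1+9/\alpha}$.
   Context: $n\ge1$ is an integer, $X_1,\dots,X_n$ are i.i.d. copies of $X$, $\widehat\Sigma_n=\frac1n\sum_{i=1}^nX_iX_i^\top$, $\lambda_{\min}(A)$ denotes the smallest eigenvalue of a symmetric matrix $A$, $S^{d-1}$ is the Euclidean unit sphere of $\mathbb R^d$ and $I_d$ the identity matrix. *)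

theory Defs
  imports "HOL-Probability.Probability"
begin

definition eigenvalue :: "real^'d^'d \<Rightarrow> real \<Rightarrow> bool" where
  "eigenvalue A k \<longleftrightarrow> (\<exists>v. v \<noteq> 0 \<and> A *v v = k *\<^sub>R v)"

(* A symmetric real matrix has finitely many eigenvalues, at least one, all real, so LEAST denotes
   a genuine minimum there; for other matrices the value may be unspecified. *)
definition lambda_min :: "real^'d^'d \<Rightarrow> real" where
  "lambda_min A = (LEAST k. eigenvalue A k)"

definition self_outer :: "real^'d \<Rightarrow> real^'d^'d" where
  "self_outer x = (\<chi> i j. x $ i * x $ j)"

definition sample_cov :: "(nat \<Rightarrow> 'a \<Rightarrow> real^'d) \<Rightarrow> nat \<Rightarrow> 'a \<Rightarrow> real^'d^'d" where
  "sample_cov Xs n \<omega> = (1 / real n) *\<^sub>R (\<Sum>i=1..n. self_outer (Xs i \<omega>))"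

end

theory Submission
  imports Defs
begin

text \<open>
  Replace each observation by its radial truncation at norm \<open>sqrt d\<close>. This only decreases the quadratic
  form \<open>q v = (\<Sum>i. (X\<^sub>i \<bullet> v)\<^sup>2)\<close>, so if the least eigenvalue is at most \<open>t\<close>, there is a unit vector \<open>v\<close> with
  \<open>q v \<le> n * t\<close> for the truncated observations (\<open>sample_cov_lambda_min_witness\<close>). The direction \<open>v\<close> is random,
  and a union bound over a net of directions would cost a factor that grows with the dimension. Instead,
  a smoothing argument is used. A uniform point \<open>w\<close> of the ball of radius \<open>r\<close> has covariance at most
  \<open>r\<^sup>2 / d\<close> times the identity, so the average of \<open>q (v + w)\<close> is at most \<open>2 * n * (t + r\<^sup>2)\<close>; with \<open>r\<^sup>2 = t\<close> the
  form is still of order \<open>n * t\<close> on average over the ball about \<open>v\<close> (\<open>exp_neg_le_ball_average\<close>). By Jensen's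
  inequality the integral of \<open>exp (- lam * q u)\<close> over all \<open>u\<close> with norm between \<open>1 - r\<close> and \<open>1 + r\<close> is then at
  least \<open>exp (- 4 * lam * n * t)\<close> times the volume of a ball of radius \<open>r\<close>. Tonelli, independence and
  Markov's inequality yield
  \<open>exp (4 * lam * n * t) * ((1 + r) / r) ^ d * p ^ n\<close>
  as a bound for the probability, where \<open>p\<close> bounds the Laplace transform of a single \<open>(X\<^sub>i \<bullet> u)\<^sup>2\<close>
  (\<open>quadratic_form_lower_tail\<close>).

  For \<open>p\<close>, the small-ball hypothesis has to be carried over to the truncated vector. Isotropy gives
  \<open>E \<bar>X\<bar>\<^sup>2 = d\<close>, so Markov's inequality controls the effect of the truncation, and the small-ball exponent drops
  from \<open>\<alpha>\<close> to \<open>2 * \<alpha> / 3\<close> (\<open>radial_cap_small_ball\<close>). Choosing \<open>lam\<close> at the scale \<open>s = 4 * sqrt t\<close> makes \<open>p\<close> of order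
  \<open>(C * sqrt t) powr (2 * \<alpha> / 3)\<close>. With \<open>d \<le> \<alpha> * n / 6\<close> the powers of \<open>t\<close> then combine to
  \<open>t powr (\<alpha> * n / 6)\<close> (\<open>tail_constant_bound\<close>).
\<close>

section \<open>The least eigenvalue of a sample covariance matrix\<close>

text \<open>A minimiser \<open>v\<close> of the Rayleigh quotient on the compact unit sphere is an eigenvector: with \<open>m\<close> the
minimum, the quadratic form of \<open>A - m I\<close> is nonnegative and vanishes at \<open>v\<close>, so its first-order
variation at \<open>v\<close> in every direction is zero. This shows that the \<^const>\<open>Least\<close> in \<^const>\<open>lambda_min\<close>
is attained.\<close>

lemma symmetric_matrix_has_least_eigenvalue:
  fixes A :: "real^'d^'d"
  assumes sym: "transpose A = A"
  shows "\<exists>v\<in>sphere 0 1. lambda_min A = v \<bullet> (A *v v)"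
proof -
  have adj: "x \<bullet> (A *v y) = y \<bullet> (A *v x)" for x y
    by (metis dot_lmul_matrix inner_commute sym transpose_matrix_vector)
  have "continuous_on (sphere 0 1) (\<lambda>v. v \<bullet> (A *v v))"
    by (intro continuous_intros matrix_vector_mult_linear_continuous_on)
  then have "\<exists>v\<in>sphere 0 1. \<forall>w\<in>sphere 0 1. v \<bullet> (A *v v) \<le> w \<bullet> (A *v w)"
    by (intro continuous_attains_inf) auto
  then obtain v where "v \<in> sphere 0 1"
    and "\<forall>w\<in>sphere 0 1. v \<bullet> (A *v v) \<le> w \<bullet> (A *v w)"
    by blast
  then have v: "norm v = 1" and min_v: "\<And>w. norm w = 1 \<Longrightarrow> v \<bullet> (A *v v) \<le> w \<bullet> (A *v w)"
    by simp_all
  define m where "m = v \<bullet> (A *v v)"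
  have quad: "m * (w \<bullet> w) \<le> w \<bullet> (A *v w)" for w
  proof (cases "w = 0")
    case False
    have "m \<le> sgn w \<bullet> (A *v sgn w)"
      unfolding m_def using False by (intro min_v) (simp add: norm_sgn)
    also have "\<dots> = (w \<bullet> (A *v w)) / (norm w)^2"
      by (simp add: sgn_div_norm matrix_vector_mult_scaleR power2_eq_square divide_simps)
    finally show ?thesis
      using False by (simp add: field_simps power2_norm_eq_inner)
  qed simp
  have stationary: "w \<bullet> (A *v v - m *\<^sub>R v) = 0" for w
  proof -
    let ?g = "w \<bullet> (A *v v - m *\<^sub>R v)" and ?f = "w \<bullet> (A *v w) - m * (w \<bullet> w)"
    have expand: "0 \<le> 2 * e * ?g + e^2 * ?f" for e :: real
    proof -
      have "m * ((v + e *\<^sub>R w) \<bullet> (v + e *\<^sub>R w)) \<le> (v + e *\<^sub>R w) \<bullet> (A *v (v + e *\<^sub>R w))"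
        by (rule quad)
      also have "(v + e *\<^sub>R w) \<bullet> (A *v (v + e *\<^sub>R w)) = m + 2 * e * (w \<bullet> (A *v v)) + e^2 * (w \<bullet> (A *v w))"
        using adj[of v w]
        by (simp add: matrix_vector_right_distrib matrix_vector_mult_scaleR inner_simps m_def
            power2_eq_square algebra_simps)
      also have "(v + e *\<^sub>R w) \<bullet> (v + e *\<^sub>R w) = 1 + 2 * e * (w \<bullet> v) + e^2 * (w \<bullet> w)"
        using v by (simp add: inner_simps inner_commute power2_eq_square algebra_simps
            norm_eq_1)
      finally show ?thesis
        by (simp add: inner_simps algebra_simps)
    qed
    have "\<not> ?g \<noteq> 0"
    proof
      assume g: "?g \<noteq> 0"
      (* The step e minimises the quadratic upper bound 2 e g + e^2 D, which becomes negative. *)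
      define D where "D = \<bar>?f\<bar> + 1"
      have D: "D > 0" "?f \<le> D" by (auto simp: D_def)
      define e where "e = - ?g / D"
      have "e^2 * ?f \<le> e^2 * D"
        using D by (intro mult_left_mono) auto
      with expand[of e] have "0 \<le> 2 * e * ?g + e^2 * D"
        by linarith
      also have "\<dots> = - (?g^2 / D)"
        using D by (simp add: e_def power2_eq_square field_simps del: inner_diff_right)
      also have "\<dots> < 0"
        using g D by simp
      finally show False by simp
    qed
    then show ?thesis by simp
  qed
  have "A *v v = m *\<^sub>R v"
    using stationary[of "A *v v - m *\<^sub>R v"] by simp
  then have "eigenvalue A m"
    unfolding eigenvalue_def using v by (intro exI[of _ v]) auto
  moreover have "m \<le> k" if "eigenvalue A k" for k
  proof -
    from that obtain w where "w \<noteq> 0" "A *v w = k *\<^sub>R w"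
      unfolding eigenvalue_def by blast
    then show ?thesis using quad[of w] by simp
  qed
  ultimately have "lambda_min A = m"
    unfolding lambda_min_def by (rule Least_equality)
  then show ?thesis
    using v by (intro bexI[of _ v]) (auto simp: m_def)
qed

lemma transpose_sample_cov: "transpose (sample_cov Xs n \<omega>) = sample_cov Xs n \<omega>"
  by (simp add: vec_eq_iff transpose_def sample_cov_def self_outer_def mult.commute)

lemma self_outer_mult_vec:
  fixes v x :: "real^'d"
  shows "self_outer x *v v = (x \<bullet> v) *\<^sub>R x" 
  by (simp add: vec_eq_iff self_outer_def matrix_vector_mult_def inner_vec_def
      sum_distrib_left mult_ac)

lemma sum_self_outer_mult_vec:
  fixes Xs :: "nat \<Rightarrow> 'a \<Rightarrow> real^'d"
  shows "finite I \<Longrightarrow> (\<Sum>i\<in>I. self_outer (Xs i \<omega>)) *v v = (\<Sum>i\<in>I. (Xs i \<omega> \<bullet> v) *\<^sub>R Xs i \<omega>)"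
    by (induction I rule: finite_induct) (simp_all add: matrix_vector_mult_add_rdistrib self_outer_mult_vec)

lemma sample_cov_mult_vec:
  fixes Xs :: "nat \<Rightarrow> 'a \<Rightarrow> real^'d"
  shows "sample_cov Xs n \<omega> *v v = (1 / real n) *\<^sub>R (\<Sum>i=1..n. (Xs i \<omega> \<bullet> v) *\<^sub>R Xs i \<omega>)"
  by (simp add: sample_cov_def sum_self_outer_mult_vec flip: scaleR_matrix_vector_assoc)

lemma sample_cov_quadratic_form:
  fixes Xs :: "nat \<Rightarrow> 'a \<Rightarrow> real^'d"
  shows "v \<bullet> (sample_cov Xs n \<omega> *v v) = (\<Sum>i=1..n. (Xs i \<omega> \<bullet> v)^2) / real n"
  unfolding sample_cov_mult_vec by (simp add: inner_sum_right power2_eq_square inner_commute)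

text \<open>All that the tail estimate needs to know about the event of a small least eigenvalue.\<close>

lemma sample_cov_lambda_min_witness:
  fixes Xs :: "nat \<Rightarrow> 'a \<Rightarrow> real^'d"
  assumes "lambda_min (sample_cov Xs n \<omega>) \<le> t" "n \<ge> 1"
  obtains v where "norm v = 1" "(\<Sum>i=1..n. (Xs i \<omega> \<bullet> v)^2) \<le> real n * t"
proof -
  obtain v where "v \<in> sphere 0 1"
    "lambda_min (sample_cov Xs n \<omega>) = v \<bullet> (sample_cov Xs n \<omega> *v v)"
    using symmetric_matrix_has_least_eigenvalue[OF transpose_sample_cov[of Xs n \<omega>]] ..
  with assms that[of v] show ?thesis
    by (simp add: sample_cov_quadratic_form field_simps)
qed

section \<open>Second moments of the uniform distribution on a ball\<close>

text \<open>Invariance under reflections and swaps of coordinates already makes a covariance matrix a multiple of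
the identity: the former make coordinates uncorrelated, the latter make their variances equal. For these two
families of maps the invariance of Lebesgue measure can be read off from boxes.\<close>

lemma lborel_distr_coordinate_reflection:
  fixes b :: "'a::euclidean_space"
  assumes b: "b \<in> Basis"
  shows "distr lborel borel (\<lambda>x. x - (2 * (x \<bullet> b)) *\<^sub>R b) = (lborel :: 'a measure)"
proof -
  define c where "c j = (if j = b then -1 else 1 :: real)" for j
  have eq: "0 + (\<Sum>j\<in>Basis. (c j * (x \<bullet> j)) *\<^sub>R j) = x - (2 * (x \<bullet> b)) *\<^sub>R b" for x :: 'a
  proof (rule euclidean_eqI)
    fix k :: 'a assume "k \<in> Basis"
    then show "(0 + (\<Sum>j\<in>Basis. (c j * (x \<bullet> j)) *\<^sub>R j)) \<bullet> k = (x - (2 * (x \<bullet> b)) *\<^sub>R b) \<bullet> k"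
      using b by (auto simp: inner_simps c_def inner_Basis)
  qed
  have "lborel = density (distr lborel borel (\<lambda>x::'a. x - (2 * (x \<bullet> b)) *\<^sub>R b))
                   (\<lambda>_. \<Prod>j\<in>(Basis::'a set). \<bar>c j\<bar>)"
    using lborel_affine_euclidean[of c 0] unfolding eq by (simp add: c_def)
  also have "(\<Prod>j\<in>(Basis::'a set). \<bar>c j\<bar>) = 1"
    by (intro prod.neutral) (simp add: c_def)
  finally show ?thesis
    by (simp add: density_1)
qed

lemma lborel_distr_coordinate_swap:
  fixes b c :: "'a::euclidean_space"
  assumes b: "b \<in> Basis" and c: "c \<in> Basis" and ne: "b \<noteq> c"
  shows "distr lborel borel (\<lambda>x. x - (x \<bullet> b - x \<bullet> c) *\<^sub>R (b - c)) = (lborel :: 'a measure)"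
proof (rule sym, rule lborel_eqI)
  let ?T = "\<lambda>x::'a. x - (x \<bullet> b - x \<bullet> c) *\<^sub>R (b - c)"
  let ?p = "Transposition.transpose b c"
  have coord: "?T x \<bullet> k = x \<bullet> ?p k" if "k \<in> Basis" for x k
    using that b c ne by (auto simp: Transposition.transpose_def inner_simps inner_Basis)
  have p_Basis: "?p k \<in> Basis \<longleftrightarrow> k \<in> Basis" for k
    using b c by (auto simp: Transposition.transpose_def)
  have p_bij: "bij_betw ?p Basis Basis"
    by (rule bij_betwI[where g = ?p]) (auto simp: p_Basis)
  fix l u :: 'a
  assume le: "\<And>k. k \<in> Basis \<Longrightarrow> l \<bullet> k \<le> u \<bullet> k"
  have "x \<in> ?T -` box l u \<longleftrightarrow> x \<in> box (?T l) (?T u)" for x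
  proof -
    have "x \<in> ?T -` box l u \<longleftrightarrow> (\<forall>k\<in>Basis. l \<bullet> k < x \<bullet> ?p k \<and> x \<bullet> ?p k < u \<bullet> k)"
      unfolding vimage_eq mem_box by (intro ball_cong refl) (simp only: coord)
    also have "\<dots> \<longleftrightarrow> (\<forall>k\<in>Basis. l \<bullet> ?p k < x \<bullet> ?p (?p k) \<and> x \<bullet> ?p (?p k) < u \<bullet> ?p k)"
      by (rule bij_betw_ball[OF p_bij])
    also have "\<dots> \<longleftrightarrow> x \<in> box (?T l) (?T u)"
      unfolding mem_box by (intro ball_cong refl) (simp only: coord transpose_involutory)
    finally show ?thesis .
  qed
  then have "?T -` box l u = box (?T l) (?T u)"
    by blast
  moreover have "?T \<in> borel_measurable borel" by simp
  ultimately have "emeasure (distr lborel borel ?T) (box l u) = emeasure lborel (box (?T l) (?T u))"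
    by (subst emeasure_distr) (auto simp del: inner_diff_left)
  also have "\<dots> = (\<Prod>k\<in>Basis. (?T u - ?T l) \<bullet> k)"
    by (rule emeasure_lborel_box) (simp add: coord le p_Basis del: inner_diff_left)
  also have "(\<Prod>k\<in>Basis. (?T u - ?T l) \<bullet> k) = (\<Prod>k\<in>Basis. (u - l) \<bullet> ?p k)"
    by (intro prod.cong refl) (simp only: inner_diff_left[of "?T u" "?T l"] coord inner_diff_left[of u l])
  also have "\<dots> = (\<Prod>k\<in>Basis. (u - l) \<bullet> k)"
    using prod.reindex_bij_betw[OF p_bij, of "\<lambda>k. (u - l) \<bullet> k"] .
  finally show "emeasure (distr lborel borel ?T) (box l u) = (\<Prod>k\<in>Basis. (u - l) \<bullet> k)" .
qed simp

lemma distr_uniform_measure_invariant: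
  assumes inv: "distr M M T = M" and T [measurable]: "T \<in> measurable M M"
    and A [measurable]: "A \<in> sets M" and TA: "\<And>x. x \<in> space M \<Longrightarrow> T x \<in> A \<longleftrightarrow> x \<in> A"
  shows "distr (uniform_measure M A) (uniform_measure M A) T = uniform_measure M A"
proof (rule measure_eqI)
  have TU: "T \<in> measurable (uniform_measure M A) (uniform_measure M A)"
    using T by (simp cong: measurable_cong_sets)
  fix B assume "B \<in> sets (distr (uniform_measure M A) (uniform_measure M A) T)"
  then have B [measurable]: "B \<in> sets M" by simp
  have "emeasure (distr (uniform_measure M A) (uniform_measure M A) T) B
      = emeasure M (A \<inter> (T -` B \<inter> space M)) / emeasure M A"
    using TU by (subst emeasure_distr) auto
  also have "A \<inter> (T -` B \<inter> space M) = T -` (A \<inter> B) \<inter> space M"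
    using TA by auto
  also have "emeasure M \<dots> = emeasure (distr M M T) (A \<inter> B)"
    by (subst emeasure_distr) auto
  also have "\<dots> = emeasure M (A \<inter> B)" by (simp add: inv)
  finally show "emeasure (distr (uniform_measure M A) (uniform_measure M A) T) B
      = emeasure (uniform_measure M A) B"
    by simp
qed simp

abbreviation uniform_ball :: "real \<Rightarrow> 'a::euclidean_space measure" where
  "uniform_ball r \<equiv> uniform_measure lborel (ball 0 r)"

lemma uniform_ball_isometry_invariant:
  fixes T :: "'a::euclidean_space \<Rightarrow> 'a"
  assumes inv: "distr lborel borel T = lborel" and T [measurable]: "T \<in> borel_measurable borel"
    and norm_T: "\<And>x. norm (T x) = norm x" and f [measurable]: "f \<in> borel_measurable borel"
  shows "(\<integral>w. f (T w) \<partial>uniform_ball r) = (\<integral>w. f w \<partial>uniform_ball r :: real)"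
proof -
  have "distr lborel lborel T = lborel"
    using inv by (simp cong: distr_cong)
  then have D: "distr (uniform_ball r) (uniform_ball r) T = uniform_ball r"
    by (intro distr_uniform_measure_invariant) (auto simp: norm_T)
  have "(\<integral>w. f (T w) \<partial>uniform_ball r) = (\<integral>w. f w \<partial>distr (uniform_ball r) (uniform_ball r) T)"
    by (rule integral_distr[symmetric]) (simp_all cong: measurable_cong_sets)
  then show ?thesis by (simp only: D)
qed

context
  fixes r :: real
  assumes r: "r > 0"
begin

lemma prob_space_uniform_ball: "prob_space (uniform_ball r :: 'a::euclidean_space measure)"
  using r unit_ball_vol_pos[of "DIM('a)"]
  by (intro prob_space_uniform_measure) (auto simp: emeasure_ball simp del: unit_ball_vol_pos)

lemma integrable_uniform_ball:
  fixes f :: "'a::euclidean_space \<Rightarrow> real"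
  assumes [measurable]: "f \<in> borel_measurable borel"
    and bound: "\<And>w. norm w \<le> r \<Longrightarrow> \<bar>f w\<bar> \<le> B"
  shows "integrable (uniform_ball r) f"
proof -
  interpret prob_space "uniform_ball r :: 'a measure" by (rule prob_space_uniform_ball)
  show ?thesis
  proof (rule integrable_const_bound[where B = B])
    show "AE x in uniform_ball r. norm (f x) \<le> B"
      by (rule AE_uniform_measureI) (auto intro!: bound)
  qed simp
qed

lemma integrable_uniform_ball_moment:
  "integrable (uniform_ball r) (\<lambda>w::'a::euclidean_space. (w \<bullet> x) * (w \<bullet> y))"
proof (rule integrable_uniform_ball[where B = "(r * norm x) * (r * norm y)"])
  fix w :: 'a assume w: "norm w \<le> r"
  have "\<bar>w \<bullet> z\<bar> \<le> r * norm z" for z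
    using Cauchy_Schwarz_ineq2[of w z] mult_right_mono[OF w norm_ge_zero[of z]] by linarith
  then show "\<bar>(w \<bullet> x) * (w \<bullet> y)\<bar> \<le> (r * norm x) * (r * norm y)"
    unfolding abs_mult using r by (intro mult_mono) auto
qed simp

lemma uniform_ball_coordinates_uncorrelated:
  fixes b c :: "'a::euclidean_space"
  assumes "b \<in> Basis" "c \<in> Basis" "b \<noteq> c"
  shows "(\<integral>w. (w \<bullet> b) * (w \<bullet> c) \<partial>uniform_ball r) = 0"
proof -
  let ?T = "\<lambda>x::'a. x - (2 * (x \<bullet> b)) *\<^sub>R b"
  have norm_T: "norm (?T x) = norm x" for x
    using assms by (simp add: norm_eq inner_simps inner_commute algebra_simps inner_Basis)
  have "(\<integral>w. (?T w \<bullet> b) * (?T w \<bullet> c) \<partial>uniform_ball r) = (\<integral>w. (w \<bullet> b) * (w \<bullet> c) \<partial>uniform_ball r)"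
    by (rule uniform_ball_isometry_invariant[OF lborel_distr_coordinate_reflection[OF assms(1)]])
       (simp_all add: norm_T del: inner_diff_left)
  moreover have "(?T w \<bullet> b) * (?T w \<bullet> c) = - ((w \<bullet> b) * (w \<bullet> c))" for w
    using assms by (simp add: inner_simps inner_Basis algebra_simps)
  ultimately show ?thesis
    by simp
qed

lemma uniform_ball_coordinate_second_moment_eq:
  fixes b c :: "'a::euclidean_space"
  assumes "b \<in> Basis" "c \<in> Basis"
  shows "(\<integral>w. (w \<bullet> b) * (w \<bullet> b) \<partial>uniform_ball r) = (\<integral>w. (w \<bullet> c) * (w \<bullet> c) \<partial>uniform_ball r)"
proof (cases "b = c")
  case False
  let ?T = "\<lambda>x::'a. x - (x \<bullet> b - x \<bullet> c) *\<^sub>R (b - c)"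
  have norm_T: "norm (?T x) = norm x" for x
    using assms False by (simp add: norm_eq inner_simps inner_commute algebra_simps inner_Basis)
  have "(\<integral>w. (?T w \<bullet> c) * (?T w \<bullet> c) \<partial>uniform_ball r) = (\<integral>w. (w \<bullet> c) * (w \<bullet> c) \<partial>uniform_ball r)"
    by (rule uniform_ball_isometry_invariant[OF lborel_distr_coordinate_swap[OF assms False]])
       (simp_all add: norm_T del: inner_diff_left)
  moreover have "?T w \<bullet> c = w \<bullet> b" for w
    using assms False by (simp add: inner_simps inner_Basis algebra_simps)
  ultimately show ?thesis
    by simp
qed simp

lemma uniform_ball_coordinate_second_moment_le:
  fixes b :: "'a::euclidean_space"
  assumes b: "b \<in> Basis"
  shows "(\<integral>w. (w \<bullet> b) * (w \<bullet> b) \<partial>uniform_ball r) \<le> r^2 / DIM('a)"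
proof -
  interpret prob_space "uniform_ball r :: 'a measure" by (rule prob_space_uniform_ball)
  have "DIM('a) * (\<integral>w. (w \<bullet> b) * (w \<bullet> b) \<partial>uniform_ball r)
      = (\<Sum>c\<in>(Basis::'a set). \<integral>w. (w \<bullet> b) * (w \<bullet> b) \<partial>uniform_ball r)"
    by simp
  also have "\<dots> = (\<Sum>c\<in>(Basis::'a set). \<integral>w. (w \<bullet> c) * (w \<bullet> c) \<partial>uniform_ball r)"
    using b by (intro sum.cong refl uniform_ball_coordinate_second_moment_eq)
  also have "\<dots> = (\<integral>w. (\<Sum>c\<in>(Basis::'a set). (w \<bullet> c) * (w \<bullet> c)) \<partial>uniform_ball r)"
    by (rule Bochner_Integration.integral_sum[symmetric]) (rule integrable_uniform_ball_moment)
  also have "\<dots> \<le> r^2"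
  proof (rule integral_le_const)
    show "AE w in uniform_ball r. (\<Sum>c\<in>(Basis::'a set). (w \<bullet> c) * (w \<bullet> c)) \<le> r^2"
    proof (rule AE_uniform_measureI)
      show "AE w in lborel. w \<in> ball 0 r \<longrightarrow> (\<Sum>c\<in>(Basis::'a set). (w \<bullet> c) * (w \<bullet> c)) \<le> r^2"
        by (auto simp flip: euclidean_inner power2_norm_eq_inner intro!: AE_I2 power_mono)
    qed simp
  qed (intro Bochner_Integration.integrable_sum integrable_uniform_ball_moment)
  finally show ?thesis
    by (simp add: field_simps)
qed

text \<open>A uniform point of a ball of radius \<open>r\<close> has covariance at most \<open>r\<^sup>2 / d\<close> times the identity. The factor
\<open>1 / d\<close> is what keeps the final constant free of the dimension: a vector of norm \<open>sqrt d\<close> contributes only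
\<open>r\<^sup>2\<close> on average, where the Cauchy-Schwarz bound would give \<open>d * r\<^sup>2\<close>.\<close>

lemma uniform_ball_second_moment_le:
  fixes x :: "'a::euclidean_space"
  shows "(\<integral>w. (x \<bullet> w)^2 \<partial>uniform_ball r) \<le> (norm x)^2 * r^2 / DIM('a)"
proof -
  have "(\<integral>w. (x \<bullet> w)^2 \<partial>uniform_ball r)
      = (\<integral>w. (\<Sum>b\<in>Basis. \<Sum>c\<in>Basis. ((x \<bullet> b) * (x \<bullet> c)) * ((w \<bullet> b) * (w \<bullet> c))) \<partial>uniform_ball r)"
  proof (rule Bochner_Integration.integral_cong[OF refl])
    fix w :: 'a
    have "(x \<bullet> w)^2 = (\<Sum>b\<in>Basis. (x \<bullet> b) * (w \<bullet> b)) * (\<Sum>c\<in>Basis. (x \<bullet> c) * (w \<bullet> c))"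
      unfolding power2_eq_square by (intro arg_cong2[where f = "(*)"] euclidean_inner)
    then show "(x \<bullet> w)^2 = (\<Sum>b\<in>Basis. \<Sum>c\<in>Basis. ((x \<bullet> b) * (x \<bullet> c)) * ((w \<bullet> b) * (w \<bullet> c)))"
      by (simp add: sum_product mult_ac)
  qed
  also have "\<dots> = (\<Sum>b\<in>Basis. \<Sum>c\<in>Basis. ((x \<bullet> b) * (x \<bullet> c)) * (\<integral>w. (w \<bullet> b) * (w \<bullet> c) \<partial>uniform_ball r))"
    by (simp add: Bochner_Integration.integral_sum integrable_uniform_ball_moment)
  also have "\<dots> = (\<Sum>b\<in>Basis. (x \<bullet> b)^2 * (\<integral>w. (w \<bullet> b) * (w \<bullet> b) \<partial>uniform_ball r))"
  proof (rule sum.cong[OF refl])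
    fix b :: 'a assume b: "b \<in> Basis"
    have "(\<Sum>c\<in>Basis. ((x \<bullet> b) * (x \<bullet> c)) * (\<integral>w. (w \<bullet> b) * (w \<bullet> c) \<partial>uniform_ball r))
        = (\<Sum>c\<in>Basis. if c = b then (x \<bullet> b)^2 * (\<integral>w. (w \<bullet> b) * (w \<bullet> b) \<partial>uniform_ball r) else 0)"
      using b by (intro sum.cong refl)
        (auto simp: uniform_ball_coordinates_uncorrelated power2_eq_square)
    then show "(\<Sum>c\<in>Basis. ((x \<bullet> b) * (x \<bullet> c)) * (\<integral>w. (w \<bullet> b) * (w \<bullet> c) \<partial>uniform_ball r))
        = (x \<bullet> b)^2 * (\<integral>w. (w \<bullet> b) * (w \<bullet> b) \<partial>uniform_ball r)"
      using b by simp
  qed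
  also have "\<dots> \<le> (\<Sum>b\<in>Basis. (x \<bullet> b)^2 * (r^2 / DIM('a)))"
    by (intro sum_mono mult_left_mono uniform_ball_coordinate_second_moment_le) auto
  also have "\<dots> = (norm x)^2 * (r^2 / DIM('a))"
    unfolding sum_distrib_right[symmetric] power2_norm_eq_inner
    by (subst euclidean_inner[of x x]) (simp add: power2_eq_square)
  finally show ?thesis by simp
qed

end

section \<open>From one bad direction to a region of bad directions\<close>

text \<open>Jensen's inequality for \<open>exp (- y)\<close>, obtained by integrating the tangent line at the expectation.\<close>

lemma (in prob_space) exp_neg_le_expectation_exp_neg:
  fixes Y :: "'a \<Rightarrow> real"
  assumes Y: "integrable M Y" and E: "integrable M (\<lambda>x. exp (- Y x))"
    and m: "expectation Y \<le> m"
  shows "exp (- m) \<le> expectation (\<lambda>x. exp (- Y x))"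
proof -
  have "exp (- m) \<le> exp (- expectation Y)" using m by simp
  also have "\<dots> = expectation (\<lambda>x. exp (- expectation Y) * (1 + (expectation Y - Y x)))"
    using Y by (simp add: prob_space)
  also have "\<dots> \<le> expectation (\<lambda>x. exp (- Y x))"
  proof (rule integral_mono)
    show "exp (- expectation Y) * (1 + (expectation Y - Y x)) \<le> exp (- Y x)" for x
      using exp_ge_add_one_self[of "expectation Y - Y x"]
        mult_left_mono[of "1 + (expectation Y - Y x)" "exp (expectation Y - Y x)" "exp (- expectation Y)"]
      by (simp flip: exp_add)
  qed (use Y E in auto)
  finally show ?thesis .
qed

text \<open>If the quadratic form \<open>q u = (\<Sum>i\<in>I. (x i \<bullet> u)\<^sup>2)\<close> is small at \<open>v\<close>, then it is small on average near \<open>v\<close>,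
since \<open>q (v + w) \<le> 2 * q v + 2 * q w\<close> and the mean of \<open>q w\<close> over the ball is at most \<open>card I * r\<^sup>2\<close> for
vectors of norm at most \<open>sqrt d\<close>. Jensen's inequality transfers this to the exponential.\<close>

lemma exp_neg_le_ball_average:
  fixes x :: "'i \<Rightarrow> 'a::euclidean_space" and r t lam :: real
  assumes r: "r > 0" and I: "finite I" and lam: "lam \<ge> 0"
    and bound: "\<And>i. i \<in> I \<Longrightarrow> (norm (x i))^2 \<le> DIM('a)"
    and v: "(\<Sum>i\<in>I. (x i \<bullet> v)^2) \<le> card I * t"
  shows "exp (- (lam * (2 * card I * (t + r^2))))
    \<le> (\<integral>w. exp (- (lam * (\<Sum>i\<in>I. (x i \<bullet> (v + w))^2))) \<partial>uniform_ball r)"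
proof -
  interpret prob_space "uniform_ball r :: 'a measure" by (rule prob_space_uniform_ball[OF r])
  have int_sq: "integrable (uniform_ball r) (\<lambda>w. (y \<bullet> w)^2)" for y :: 'a
    using integrable_uniform_ball_moment[OF r, of y y]
    by (simp add: power2_eq_square inner_commute[of y])
  let ?q = "\<lambda>u. \<Sum>i\<in>I. (x i \<bullet> u)^2"
  have q_bound: "?q (v + w) \<le> 2 * (card I * t) + 2 * ?q w" for w
  proof -
    have "?q (v + w) \<le> (\<Sum>i\<in>I. 2 * (x i \<bullet> v)^2 + 2 * (x i \<bullet> w)^2)"
    proof (rule sum_mono)
      fix i
      show "(x i \<bullet> (v + w))^2 \<le> 2 * (x i \<bullet> v)^2 + 2 * (x i \<bullet> w)^2"
        using zero_le_power2[of "x i \<bullet> v - x i \<bullet> w"]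
        by (simp add: inner_add_right power2_eq_square algebra_simps)
    qed
    also have "\<dots> = 2 * ?q v + 2 * ?q w"
      by (simp add: sum.distrib sum_distrib_left)
    finally show ?thesis using v by linarith
  qed
  let ?Y = "\<lambda>w. lam * (2 * (card I * t) + 2 * ?q w)"
  have Y: "integrable (uniform_ball r) ?Y"
    by (intro integrable_mult_right Bochner_Integration.integrable_add integrable_const
        Bochner_Integration.integrable_sum int_sq)
  have nonneg: "?q v \<ge> 0" by (intro sum_nonneg) simp
  have "2 * (card I * t) + 2 * ?q w \<ge> 0" for w
  proof -
    have "?q w \<ge> 0" by (intro sum_nonneg) simp
    then show ?thesis using nonneg v by linarith
  qed
  then have "?Y w \<ge> 0" for w
    using lam by (intro mult_nonneg_nonneg)
  then have E: "integrable (uniform_ball r) (\<lambda>w. exp (- ?Y w))"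
    by (intro integrable_const_bound[where B = 1]) auto
  have "expectation ?q \<le> card I * r^2"
  proof -
    have "expectation ?q = (\<Sum>i\<in>I. expectation (\<lambda>w. (x i \<bullet> w)^2))"
      by (rule Bochner_Integration.integral_sum) (rule int_sq)
    also have "\<dots> \<le> (\<Sum>i\<in>I. r^2)"
    proof (rule sum_mono)
      fix i assume "i \<in> I"
      have "expectation (\<lambda>w. (x i \<bullet> w)^2) \<le> (norm (x i))^2 * r^2 / DIM('a)"
        by (rule uniform_ball_second_moment_le[OF r])
      also have "\<dots> \<le> DIM('a) * r^2 / DIM('a)"
        using bound[OF \<open>i \<in> I\<close>] by (intro divide_right_mono mult_right_mono) auto
      finally show "expectation (\<lambda>w. (x i \<bullet> w)^2) \<le> r^2" by simp
    qed
    finally show ?thesis by simp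
  qed
  moreover have "expectation ?Y = lam * (2 * (card I * t) + 2 * expectation ?q)"
    using prob_space by (simp add: Bochner_Integration.integrable_sum int_sq)
  ultimately have "expectation ?Y \<le> lam * (2 * card I * (t + r^2))"
    using lam by (auto intro!: mult_left_mono simp: algebra_simps)
  then have "exp (- (lam * (2 * card I * (t + r^2)))) \<le> expectation (\<lambda>w. exp (- ?Y w))"
    by (rule exp_neg_le_expectation_exp_neg[OF Y E])
  also have "\<dots> \<le> expectation (\<lambda>w. exp (- (lam * ?q (v + w))))"
  proof (rule integral_mono[OF E])
    show "integrable (uniform_ball r) (\<lambda>w. exp (- (lam * ?q (v + w))))"
      using lam by (intro integrable_const_bound[where B = 1]) (auto intro!: AE_I2 mult_nonneg_nonneg sum_nonneg)
    show "exp (- ?Y w) \<le> exp (- (lam * ?q (v + w)))" for w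
      using mult_left_mono[OF q_bound lam] by simp
  qed
  finally show ?thesis .
qed

text \<open>The ball of radius \<open>r\<close> about the unknown unit vector \<open>v\<close> lies in a shell that does not depend on \<open>v\<close>.
Replacing the ball by the shell gives a bound without \<open>v\<close>, which can be integrated over the probability
space. The shell keeps away from the origin, where the small-ball estimate would be lost.\<close>

lemma exp_neg_le_shell_integral:
  fixes x :: "'i \<Rightarrow> 'a::euclidean_space" and r t lam :: real
  assumes r: "r > 0" and I: "finite I" and lam: "lam \<ge> 0"
    and bound: "\<And>i. i \<in> I \<Longrightarrow> (norm (x i))^2 \<le> DIM('a)"
    and v: "(\<Sum>i\<in>I. (x i \<bullet> v)^2) \<le> card I * t" "norm v = 1"
  shows "ennreal (exp (- (lam * (2 * card I * (t + r^2)))))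
    \<le> (\<integral>\<^sup>+u. ennreal (exp (- (lam * (\<Sum>i\<in>I. (x i \<bullet> u)^2)))) * indicator (cball 0 (1 + r) - ball 0 (1 - r)) u \<partial>lborel)
        / emeasure lborel (ball (0::'a) r)"
proof -
  let ?f = "\<lambda>u. exp (- (lam * (\<Sum>i\<in>I. (x i \<bullet> u)^2)))"
  let ?S = "cball 0 (1 + r) - ball 0 (1 - r) :: 'a set"
  have S: "?S \<in> sets borel" by (intro sets.Diff) simp_all
  have f_int: "integrable (uniform_ball r) (\<lambda>w. ?f (v + w))"
    using lam by (intro integrable_uniform_ball[OF r, where B = 1]) (auto intro!: mult_nonneg_nonneg sum_nonneg)
  have "ennreal (exp (- (lam * (2 * card I * (t + r^2))))) \<le> ennreal (\<integral>w. ?f (v + w) \<partial>uniform_ball r)"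
    by (intro ennreal_leI exp_neg_le_ball_average assms)
  also have "\<dots> = (\<integral>\<^sup>+w. ennreal (?f (v + w)) \<partial>uniform_ball r)"
    using f_int by (rule nn_integral_eq_integral[symmetric]) simp
  also have "\<dots> = (\<integral>\<^sup>+w. ennreal (?f (v + w)) * indicator (ball 0 r) w \<partial>lborel) / emeasure lborel (ball (0::'a) r)"
    by (rule nn_integral_uniform_measure) simp_all
  also have "\<dots> \<le> (\<integral>\<^sup>+w. ennreal (?f (v + w)) * indicator ?S (v + w) \<partial>lborel) / emeasure lborel (ball (0::'a) r)"
  proof (intro divide_right_mono_ennreal nn_integral_mono mult_left_mono)
    fix w :: 'a
    show "indicator (ball 0 r) w \<le> (indicator ?S (v + w) :: ennreal)"
      using norm_triangle_ineq[of v w] norm_diff_ineq[of v w] v(2)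
      by (auto simp: indicator_def)
  qed simp
  also have "(\<integral>\<^sup>+w. ennreal (?f (v + w)) * indicator ?S (v + w) \<partial>lborel)
      = (\<integral>\<^sup>+u. ennreal (?f u) * indicator ?S u \<partial>distr lborel borel ((+) v))"
    by (subst nn_integral_distr) (use S in measurable)
  finally show ?thesis
    by (simp only: lborel_distr_plus)
qed

section \<open>Truncation and the one-dimensional Laplace transform\<close>

definition radial_cap :: "real \<Rightarrow> 'a::euclidean_space \<Rightarrow> 'a" where
  "radial_cap R x = (if norm x \<le> R then x else (R / norm x) *\<^sub>R x)"

lemma borel_measurable_radial_cap [measurable]: "radial_cap R \<in> borel_measurable borel"
  unfolding radial_cap_def by measurable

lemma norm_radial_cap_le: "R \<ge> 0 \<Longrightarrow> norm (radial_cap R x) \<le> R"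
  by (auto simp: radial_cap_def)

lemma radial_cap_inner_sq_le:
  assumes "R \<ge> 0"
  shows "(radial_cap R x \<bullet> v)^2 \<le> (x \<bullet> v)^2"
proof (cases "norm x \<le> R")
  case False
  then have "0 \<le> R / norm x" "R / norm x \<le> 1"
    using assms by (auto simp: divide_le_eq)
  then have "(R / norm x)^2 \<le> 1" by (simp add: power_le_one)
  then have "(R / norm x)^2 * (x \<bullet> v)^2 \<le> 1 * (x \<bullet> v)^2"
    by (intro mult_right_mono) auto
  then show ?thesis
    using False by (simp only: radial_cap_def if_False inner_scaleR_left power_mult_distrib mult_1)
qed (simp add: radial_cap_def)

lemma abs_inner_le_radial_cap:
  assumes "b \<ge> 1" "R > 0" "norm x \<le> b * R"
  shows "\<bar>x \<bullet> u\<bar> \<le> b * \<bar>radial_cap R x \<bullet> u\<bar>"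
proof (cases "norm x \<le> R")
  case True
  with assms show ?thesis by (simp add: radial_cap_def mult_le_cancel_right1)
next
  case False
  then have x: "norm x > 0" using assms by linarith
  have "1 \<le> b * (R / norm x)" using assms x by (simp add: field_simps)
  then have "1 * \<bar>x \<bullet> u\<bar> \<le> b * (R / norm x) * \<bar>x \<bullet> u\<bar>" by (intro mult_right_mono) auto
  with False assms show ?thesis by (simp add: radial_cap_def abs_mult)
qed

context prob_space
begin

text \<open>Truncation at radius \<open>R\<close> makes \<open>X\<close> bounded and costs part of the small-ball exponent. For any \<open>b \<ge> 1\<close>, a
small inner product of the truncated vector forces an inner product of \<open>X\<close> that is at most \<open>b\<close> times as
large, unless the norm of \<open>X\<close> exceeds \<open>b * R\<close>, an event of probability at most \<open>1 / b\<^sup>2\<close> by Markov's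
inequality.\<close>

lemma radial_cap_small_ball:
  fixes X :: "'a \<Rightarrow> 'b::euclidean_space"
  assumes X [measurable]: "X \<in> borel_measurable M"
    and sq: "integrable M (\<lambda>\<omega>. (norm (X \<omega>))^2)" "expectation (\<lambda>\<omega>. (norm (X \<omega>))^2) \<le> R^2"
    and small: "\<And>\<theta> s. norm \<theta> = 1 \<Longrightarrow> s > 0 \<Longrightarrow> prob {\<omega>\<in>space M. \<bar>\<theta> \<bullet> X \<omega>\<bar> \<le> s} \<le> (C * s) powr \<alpha>"
    and pos: "C > 0" "0 < \<alpha>" "\<alpha> \<le> 1" "R > 0" "s > 0" "\<rho> > 0"
    and u: "norm u \<ge> \<rho>" and y: "C * s / \<rho> \<le> 1"
  shows "prob {\<omega>\<in>space M. \<bar>radial_cap R (X \<omega>) \<bullet> u\<bar> \<le> s} \<le> 2 * (C * s / \<rho>) powr (2 * \<alpha> / 3)"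
proof -
  define y where "y = C * s / \<rho>"
  have y0: "0 < y" "y \<le> 1" using pos y by (auto simp: y_def)
  (* This b balances (y b)^alpha against b^(-2) when alpha = 1, and is good enough below. *)
  define b where "b = y powr (-1/3)"
  have b1: "b \<ge> 1"
  proof -
    have "1 powr (-1/3) \<le> y powr (-1/3)"
      using y0 by (intro powr_mono2') auto
    then show ?thesis by (simp only: b_def powr_one_eq_one)
  qed
  have "{\<omega>\<in>space M. \<bar>radial_cap R (X \<omega>) \<bullet> u\<bar> \<le> s}
     \<subseteq> {\<omega>\<in>space M. \<bar>sgn u \<bullet> X \<omega>\<bar> \<le> b * s / \<rho>} \<union> {\<omega>\<in>space M. (norm (X \<omega>))^2 \<ge> (b * R)^2}"
  proof safe
    fix \<omega> assume "\<omega> \<in> space M" and cap: "\<bar>radial_cap R (X \<omega>) \<bullet> u\<bar> \<le> s"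
      and "\<not> (b * R)^2 \<le> (norm (X \<omega>))^2"
    then have "norm (X \<omega>) \<le> b * R"
      using b1 pos by (auto intro: power2_le_imp_le[where y = "b * R"])
    then have "\<bar>X \<omega> \<bullet> u\<bar> \<le> b * \<bar>radial_cap R (X \<omega>) \<bullet> u\<bar>"
      using b1 pos by (intro abs_inner_le_radial_cap)
    also have "\<dots> \<le> b * s"
      using cap b1 by (intro mult_left_mono) auto
    finally have "\<bar>X \<omega> \<bullet> u\<bar> / norm u \<le> b * s / \<rho>"
      using u pos b1 by (intro frac_le) auto
    then show "\<bar>sgn u \<bullet> X \<omega>\<bar> \<le> b * s / \<rho>"
      by (simp add: sgn_div_norm abs_mult inner_commute divide_inverse mult.commute)
  qed
  then have "prob {\<omega>\<in>space M. \<bar>radial_cap R (X \<omega>) \<bullet> u\<bar> \<le> s}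
     \<le> prob ({\<omega>\<in>space M. \<bar>sgn u \<bullet> X \<omega>\<bar> \<le> b * s / \<rho>} \<union> {\<omega>\<in>space M. (norm (X \<omega>))^2 \<ge> (b * R)^2})"
    by (rule finite_measure_mono) measurable
  also have "\<dots> \<le> prob {\<omega>\<in>space M. \<bar>sgn u \<bullet> X \<omega>\<bar> \<le> b * s / \<rho>} + prob {\<omega>\<in>space M. (norm (X \<omega>))^2 \<ge> (b * R)^2}"
    by (rule measure_Un_le) measurable
  also have "\<dots> \<le> (C * (b * s / \<rho>)) powr \<alpha> + R^2 / (b * R)^2"
  proof (rule add_mono)
    show "prob {\<omega>\<in>space M. \<bar>sgn u \<bullet> X \<omega>\<bar> \<le> b * s / \<rho>} \<le> (C * (b * s / \<rho>)) powr \<alpha>"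
      using u pos b1 by (intro small) (auto simp: norm_sgn)
    have "prob {\<omega>\<in>space M. (norm (X \<omega>))^2 \<ge> (b * R)^2} \<le> expectation (\<lambda>\<omega>. (norm (X \<omega>))^2) / (b * R)^2"
      using b1 pos by (intro integral_Markov_inequality_measure[where A = "{}"] sq(1)) auto
    also have "\<dots> \<le> R^2 / (b * R)^2"
      by (intro divide_right_mono sq(2)) simp
    finally show "prob {\<omega>\<in>space M. (norm (X \<omega>))^2 \<ge> (b * R)^2} \<le> R^2 / (b * R)^2" .
  qed
  also have "C * (b * s / \<rho>) = y powr (2/3)"
  proof -
    have "C * (b * s / \<rho>) = y powr 1 * y powr (-1/3)"
      using y0(1) by (simp add: b_def) (simp add: y_def)
    also have "\<dots> = y powr (2/3)"
      by (simp only: powr_add[symmetric]) simp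
    finally show ?thesis .
  qed
  also have "R^2 / (b * R)^2 = y powr (2/3)"
  proof -
    have "b^2 * y powr (2/3) = y powr (-1/3 + -1/3 + 2/3)"
      by (simp only: b_def power2_eq_square powr_add)
    then have "b^2 * y powr (2/3) = 1"
      using y0 by simp
    then have "1 / b^2 = y powr (2/3)"
      using b1 by (simp add: field_simps)
    then show ?thesis
      using pos by (simp add: power_mult_distrib)
  qed
  also have "(y powr (2/3)) powr \<alpha> + y powr (2/3) \<le> 2 * y powr (2 * \<alpha> / 3)"
  proof -
    have "(y powr (2/3)) powr \<alpha> = y powr (2 * \<alpha> / 3)"
      by (simp add: powr_powr)
    moreover have "y powr (2/3) \<le> y powr (2 * \<alpha> / 3)"
      using y0 pos by (intro powr_mono') auto
    ultimately show ?thesis by linarith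
  qed
  finally show ?thesis by (simp only: y_def)
qed

lemma laplace_sq_le:
  fixes Y :: "'a \<Rightarrow> real"
  assumes Y [measurable]: "random_variable borel Y" and "lam \<ge> 0" "s \<ge> 0"
  shows "(\<integral>\<^sup>+\<omega>. ennreal (exp (- (lam * (Y \<omega>)^2))) \<partial>M)
    \<le> ennreal (prob {\<omega>\<in>space M. \<bar>Y \<omega>\<bar> \<le> s} + exp (- (lam * s^2)))"
proof -
  let ?A = "{\<omega>\<in>space M. \<bar>Y \<omega>\<bar> \<le> s}"
  have "(\<integral>\<^sup>+\<omega>. ennreal (exp (- (lam * (Y \<omega>)^2))) \<partial>M)
      \<le> (\<integral>\<^sup>+\<omega>. indicator ?A \<omega> + ennreal (exp (- (lam * s^2))) \<partial>M)"
  proof (rule nn_integral_mono)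
    fix \<omega> assume \<omega>: "\<omega> \<in> space M"
    show "ennreal (exp (- (lam * (Y \<omega>)^2))) \<le> indicator ?A \<omega> + ennreal (exp (- (lam * s^2)))"
    proof (cases "\<bar>Y \<omega>\<bar> \<le> s")
      case True
      have "exp (- (lam * (Y \<omega>)^2)) \<le> 1" using assms by simp
      then have "ennreal (exp (- (lam * (Y \<omega>)^2))) \<le> 1" by (metis ennreal_1 ennreal_leI)
      with True \<omega> show ?thesis by (simp add: add_increasing2)
    next
      case False
      then have "s^2 \<le> (Y \<omega>)^2" using assms by (intro abs_le_square_iff[THEN iffD1]) auto
      then have "exp (- (lam * (Y \<omega>)^2)) \<le> exp (- (lam * s^2))" using assms by (simp add: mult_left_mono)
      with False show ?thesis by (simp add: ennreal_leI)
    qed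
  qed
  also have "\<dots> = emeasure M ?A + ennreal (exp (- (lam * s^2)))"
    by (subst nn_integral_add) (simp_all add: emeasure_space_1)
  also have "\<dots> = ennreal (prob ?A + exp (- (lam * s^2)))"
    by (simp add: emeasure_eq_measure)
  finally show ?thesis .
qed

section \<open>A union bound over directions by volume\<close>

text \<open>On the event \<open>A\<close> the integral over the shell of \<open>exp (- lam * q u)\<close>,
divided by the volume of the ball of radius \<open>r\<close>, is at least \<open>exp (- 2 * lam * card I * (t + r\<^sup>2))\<close>. By
Tonelli and independence its expectation is at most \<open>p ^ card I\<close> times the ratio of the volumes of the
balls of radii \<open>1 + r\<close> and \<open>r\<close>. That ratio takes the place of the cardinality of a net.\<close>

lemma quadratic_form_lower_tail:
  fixes Z :: "'i \<Rightarrow> 'a \<Rightarrow> 'b::euclidean_space" and r t lam p :: real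
  assumes I: "finite I" and indep: "indep_vars (\<lambda>_. borel) Z I"
    and r: "0 < r" and lam: "lam \<ge> 0" and p: "p \<ge> 0"
    and bound: "\<And>i \<omega>. i \<in> I \<Longrightarrow> (norm (Z i \<omega>))^2 \<le> DIM('b)"
    and laplace: "\<And>i u. i \<in> I \<Longrightarrow> norm u \<ge> 1 - r \<Longrightarrow>
          (\<integral>\<^sup>+\<omega>. ennreal (exp (- (lam * (Z i \<omega> \<bullet> u)^2))) \<partial>M) \<le> ennreal p"
    and A: "A \<in> events"
    and small: "\<And>\<omega>. \<omega> \<in> A \<Longrightarrow> \<exists>v. norm v = 1 \<and> (\<Sum>i\<in>I. (Z i \<omega> \<bullet> v)^2) \<le> card I * t"
  shows "prob A \<le> exp (lam * (2 * card I * (t + r^2))) * ((1 + r) / r) ^ DIM('b) * p ^ card I"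
proof -
  let ?E = "lam * (2 * card I * (t + r^2))"
  let ?S = "cball 0 (1 + r) - ball 0 (1 - r) :: 'b set"
  let ?V = "emeasure lborel (ball (0::'b) r)"
  let ?f = "\<lambda>\<omega> u. ennreal (exp (- (lam * (\<Sum>i\<in>I. (Z i \<omega> \<bullet> u)^2))))"
  have S [measurable]: "?S \<in> sets borel" by (intro sets.Diff) simp_all
  have Z [measurable]: "Z i \<in> borel_measurable M" if "i \<in> I" for i
    using indep that unfolding indep_vars_def by simp
  interpret pair_sigma_finite M "lborel :: 'b measure" ..
  have point: "(\<integral>\<^sup>+\<omega>. ?f \<omega> u \<partial>M) \<le> ennreal (p ^ card I)" if "norm u \<ge> 1 - r" for u
  proof -
    have "(\<integral>\<^sup>+\<omega>. ?f \<omega> u \<partial>M) = (\<integral>\<^sup>+\<omega>. (\<Prod>i\<in>I. ennreal (exp (- (lam * (Z i \<omega> \<bullet> u)^2)))) \<partial>M)"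
      by (simp add: sum_distrib_left exp_sum[OF I] prod_ennreal flip: sum_negf)
    also have "\<dots> = (\<Prod>i\<in>I. \<integral>\<^sup>+\<omega>. ennreal (exp (- (lam * (Z i \<omega> \<bullet> u)^2))) \<partial>M)"
      by (intro indep_vars_nn_integral I indep_vars_compose2[OF indep]) auto
    also have "\<dots> \<le> (\<Prod>i\<in>I. ennreal p)"
      by (intro prod_mono_ennreal laplace that)
    also have "\<dots> = ennreal (p ^ card I)" using p by (simp add: ennreal_power)
    finally show ?thesis .
  qed
  have "ennreal (exp (- ?E)) * emeasure M A = (\<integral>\<^sup>+\<omega>. ennreal (exp (- ?E)) * indicator A \<omega> \<partial>M)"
    using A by (simp add: nn_integral_cmult_indicator)
  also have "\<dots> \<le> (\<integral>\<^sup>+\<omega>. (\<integral>\<^sup>+u. ?f \<omega> u * indicator ?S u \<partial>lborel) / ?V \<partial>M)"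
  proof (rule nn_integral_mono)
    fix \<omega>
    show "ennreal (exp (- ?E)) * indicator A \<omega> \<le> (\<integral>\<^sup>+u. ?f \<omega> u * indicator ?S u \<partial>lborel) / ?V"
    proof (cases "\<omega> \<in> A")
      case True
      then obtain v where "norm v = 1" "(\<Sum>i\<in>I. (Z i \<omega> \<bullet> v)^2) \<le> card I * t"
        using small by blast
      then show ?thesis
        using exp_neg_le_shell_integral[where x = "\<lambda>i. Z i \<omega>", OF r I lam bound, of v t] True by simp
    qed simp
  qed
  also have "\<dots> = (\<integral>\<^sup>+\<omega>. (\<integral>\<^sup>+u. ?f \<omega> u * indicator ?S u \<partial>lborel) \<partial>M) / ?V"
    by (rule nn_integral_divide) measurable
  also have "(\<integral>\<^sup>+\<omega>. (\<integral>\<^sup>+u. ?f \<omega> u * indicator ?S u \<partial>lborel) \<partial>M)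
      = (\<integral>\<^sup>+u. (\<integral>\<^sup>+\<omega>. ?f \<omega> u * indicator ?S u \<partial>M) \<partial>lborel)"
    by (rule Fubini'[symmetric]) measurable
  also have "\<dots> \<le> (\<integral>\<^sup>+u. ennreal (p ^ card I) * indicator (cball (0::'b) (1 + r)) u \<partial>lborel)"
  proof (rule nn_integral_mono)
    fix u :: 'b
    show "(\<integral>\<^sup>+\<omega>. ?f \<omega> u * indicator ?S u \<partial>M) \<le> ennreal (p ^ card I) * indicator (cball 0 (1 + r)) u"
    proof (cases "u \<in> ?S")
      case True
      then show ?thesis using point[of u] by simp
    qed simp
  qed
  also have "\<dots> = ennreal (p ^ card I) * emeasure lborel (cball (0::'b) (1 + r))"
    by (simp add: nn_integral_cmult_indicator)
  finally have "ennreal (exp (- ?E)) * emeasure M A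
      \<le> ennreal (p ^ card I) * emeasure lborel (cball (0::'b) (1 + r)) / ?V"
    by (simp add: divide_right_mono_ennreal)
  also have "\<dots> = ennreal (p ^ card I * ((1 + r) / r) ^ DIM('b))"
  proof -
    define V where "V = unit_ball_vol (real DIM('b))"
    have V: "V > 0" by (simp add: V_def)
    have "ennreal (p ^ card I) * emeasure lborel (cball (0::'b) (1 + r)) / ?V
        = ennreal (p ^ card I) * ennreal (V * (1 + r) ^ DIM('b)) / ennreal (V * r ^ DIM('b))"
      using r by (simp add: emeasure_cball emeasure_ball V_def)
    also have "\<dots> = ennreal (p ^ card I * (V * (1 + r) ^ DIM('b)) / (V * r ^ DIM('b)))"
    proof -
      have "0 \<le> p ^ card I * (V * (1 + r) ^ DIM('b))" "0 < V * r ^ DIM('b)"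
        using r p V by simp_all
      then show ?thesis
        using r p V by (subst ennreal_mult[symmetric]) (simp_all only: divide_ennreal, simp_all)
    qed
    also have "p ^ card I * (V * (1 + r) ^ DIM('b)) / (V * r ^ DIM('b)) = p ^ card I * ((1 + r) / r) ^ DIM('b)"
      using V by (simp add: power_divide)
    finally show ?thesis .
  qed
  finally have "ennreal (exp (- ?E) * prob A) \<le> ennreal (p ^ card I * ((1 + r) / r) ^ DIM('b))"
    by (simp add: emeasure_eq_measure ennreal_mult)
  then have "exp (- ?E) * prob A \<le> p ^ card I * ((1 + r) / r) ^ DIM('b)"
    using p r by (subst (asm) ennreal_le_iff) auto
  then have "exp ?E * (exp (- ?E) * prob A) \<le> exp ?E * (p ^ card I * ((1 + r) / r) ^ DIM('b))"
    by (rule mult_left_mono) simp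
  moreover have "exp ?E * (exp (- ?E) * prob A) = prob A"
    by (simp only: mult.assoc[symmetric] exp_add[symmetric]) simp
  ultimately show ?thesis
    by (simp only: mult_ac)
qed

end

section \<open>The lower tail of the sample covariance matrix\<close>

lemma expectation_norm_sq_isotropic:
  fixes X :: "'a \<Rightarrow> real^'d"
  assumes int: "integrable M (\<lambda>\<omega>. self_outer (X \<omega>))"
    and iso: "(\<integral>\<omega>. self_outer (X \<omega>) \<partial>M) = mat 1"
  shows "integrable M (\<lambda>\<omega>. (norm (X \<omega>))^2)" "(\<integral>\<omega>. (norm (X \<omega>))^2 \<partial>M) = CARD('d)"
proof -
  define tr where "tr = (\<lambda>A::real^'d^'d. \<Sum>i\<in>UNIV. A $ i $ i)"
  have bl: "bounded_linear tr"
    unfolding tr_def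
    by (intro bounded_linear_sum bounded_linear_compose[OF bounded_linear_vec_nth bounded_linear_vec_nth])
  have norm_tr: "(norm (X \<omega>))^2 = tr (self_outer (X \<omega>))" for \<omega>
    by (simp add: tr_def self_outer_def power2_norm_eq_inner inner_vec_def)
  show "integrable M (\<lambda>\<omega>. (norm (X \<omega>))^2)"
    unfolding norm_tr by (rule integrable_bounded_linear[OF bl int])
  have "(\<integral>\<omega>. (norm (X \<omega>))^2 \<partial>M) = tr (mat 1)"
    unfolding norm_tr by (simp add: integral_bounded_linear[OF bl int] iso)
  then show "(\<integral>\<omega>. (norm (X \<omega>))^2 \<partial>M) = CARD('d)"
    by (simp add: tr_def mat_def)
qed

lemma exp_1_ge: "(269/100::real) \<le> exp 1"
proof -
  have "(269/100::real) \<le> (41/32)^4" by (simp add: power_divide)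
  also have "\<dots> \<le> exp (1/4) ^ 4"
    using exp_lower_Taylor_quadratic[of "1/4"] by (intro power_mono) (simp_all add: power_divide)
  also have "\<dots> = exp 1" by (simp flip: exp_of_nat_mult)
  finally show ?thesis .
qed

lemma exp_10_ge: "(19500::real) \<le> exp 10"
proof -
  have "(19500::real) \<le> (269/100)^10" by (simp add: power_divide)
  also have "\<dots> \<le> exp 1 ^ 10"
    using exp_1_ge by (intro power_mono) auto
  also have "\<dots> = exp 10" by (simp flip: exp_of_nat_mult)
  finally show ?thesis .
qed

text \<open>The factor 3 that each observation contributes to the tail bound is absorbed by \<open>exp (9 / \<alpha>)\<close>, since
\<open>3 < exp (3/2)\<close>; what remains at \<open>\<alpha> = 1\<close> leaves room for the constant 79.\<close>

lemma three_powr_le: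
  assumes "0 < \<alpha>" "\<alpha> \<le> 1"
  shows "3 powr (6 / \<alpha>) * (79::real) \<le> 3 * exp (1 + 9 / \<alpha>)"
proof -
  define \<beta> where "\<beta> = 1 / \<alpha> - 1"
  have \<beta>: "\<beta> \<ge> 0" using assms by (simp add: \<beta>_def field_simps)
  have "(3::real) \<le> exp (3/2)"
    using exp_lower_Taylor_quadratic[of "3/2"] by (simp add: power2_eq_square)
  then have "3 powr (6 * \<beta>) \<le> exp (3/2) powr (6 * \<beta>)"
    using \<beta> by (intro powr_mono2) auto
  also have "\<dots> = exp (9 * \<beta>)" by (simp add: exp_powr_real)
  finally have 1: "3 powr (6 * \<beta>) \<le> exp (9 * \<beta>)" .
  have "6 / \<alpha> = 6 * \<beta> + 6" "1 + 9 / \<alpha> = 9 * \<beta> + 10"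
    by (simp_all add: \<beta>_def algebra_simps)
  then have eqs: "3 powr (6 / \<alpha>) = 3 powr (6 * \<beta>) * (729::real)"
    "exp (1 + 9 / \<alpha>) = exp (9 * \<beta>) * exp 10"
    by (simp_all only: powr_add exp_add powr_numeral) simp
  have 2: "(729::real) * 79 \<le> 3 * exp 10" using exp_10_ge by linarith
  have "3 powr (6 * \<beta>) * ((729::real) * 79) \<le> exp (9 * \<beta>) * (3 * exp 10)"
    by (rule mult_mono[OF 1 2]) auto
  then show ?thesis unfolding eqs by (simp only: mult_ac)
qed

text \<open>With \<open>s = 4 * sqrt t\<close> and \<open>lam\<close> chosen so that \<open>exp (- lam * s\<^sup>2) = \<delta> powr (2 * \<alpha> / 3)\<close>, every factor is a
power with exponent \<open>k = \<alpha> * n / 6\<close>: the Laplace transforms give \<open>\<delta> powr (4 * k)\<close>, the Chernoff factor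
gives \<open>\<delta> powr (- k)\<close>, and the volume ratio at most \<open>((21/20) / sqrt t) powr k\<close> because \<open>d \<le> k\<close>. As \<open>\<delta>\<close> is of
order \<open>C * sqrt t\<close>, the base \<open>\<delta>\<^sup>3 / sqrt t\<close> is of order \<open>C\<^sup>3 * t\<close>.\<close>

lemma tail_constant_bound:
  fixes C \<alpha> t :: real and n d :: nat
  assumes C: "C \<ge> 1" and \<alpha>: "0 < \<alpha>" "\<alpha> \<le> 1" and t: "0 < t" "t \<le> 1/400"
    and n: "real n \<ge> 6 * real d / \<alpha>"
    and \<delta>: "\<delta> = C * (4 * sqrt t) / (19/20)" "\<delta> < 1"
    and lam: "lam = (2 * \<alpha> / 3) * ln (1 / \<delta>) / (16 * t)"
  shows "exp (lam * (2 * real n * (t + t))) * ((1 + sqrt t) / sqrt t) ^ d * (3 * \<delta> powr (2 * \<alpha> / 3)) ^ n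
    \<le> (3 * C ^ 4 * exp (1 + 9 / \<alpha>) * t) powr (\<alpha> * real n / 6)"
proof -
  define k where "k = \<alpha> * real n / 6"
  have k: "k \<ge> real d" using n \<alpha> by (simp add: k_def field_simps)
  have \<delta>0: "\<delta> > 0" using C t by (simp add: \<delta>(1))
  have st: "0 < sqrt t" using t by simp
  have st_le: "sqrt t \<le> 1/20"
    using t by (intro real_le_lsqrt) (auto simp: power2_eq_square)
  have E: "exp (lam * (2 * real n * (t + t))) = \<delta> powr (- k)"
  proof -
    have "lam * (2 * real n * (t + t)) = - k * ln \<delta>"
      using t \<delta>0 by (simp add: lam k_def ln_div field_simps)
    then show ?thesis using \<delta>0 by (simp add: powr_def)
  qed
  have B: "((1 + sqrt t) / sqrt t) ^ d \<le> ((21/20) / sqrt t) powr k"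
  proof -
    have "((1 + sqrt t) / sqrt t) ^ d \<le> ((21/20) / sqrt t) ^ d"
      using st st_le by (intro power_mono divide_right_mono) auto
    also have "\<dots> = ((21/20) / sqrt t) powr (real d)"
      using st by (simp add: powr_realpow)
    also have "\<dots> \<le> ((21/20) / sqrt t) powr k"
      using k st st_le by (intro powr_mono) auto
    finally show ?thesis .
  qed
  have P: "(3 * \<delta> powr (2 * \<alpha> / 3)) ^ n = (3 powr (6 / \<alpha>)) powr k * (\<delta> powr 4) powr k"
  proof -
    have "(3 * \<delta> powr (2 * \<alpha> / 3)) ^ n = (3 * \<delta> powr (2 * \<alpha> / 3)) powr (real n)"
      using \<delta>0 by (subst powr_realpow) auto
    also have "\<dots> = 3 powr (real n) * \<delta> powr (2 * \<alpha> / 3 * real n)"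
      using \<delta>0 by (simp add: powr_mult powr_powr)
    also have "\<dots> = (3 powr (6 / \<alpha>)) powr k * (\<delta> powr 4) powr k"
      using \<alpha> by (simp add: powr_powr k_def field_simps)
    finally show ?thesis .
  qed
  have "exp (lam * (2 * real n * (t + t))) * ((1 + sqrt t) / sqrt t) ^ d * (3 * \<delta> powr (2 * \<alpha> / 3)) ^ n
      \<le> \<delta> powr (- k) * ((21/20) / sqrt t) powr k * ((3 powr (6 / \<alpha>)) powr k * (\<delta> powr 4) powr k)"
    unfolding E P using B by (intro mult_right_mono mult_left_mono) auto
  also have "\<dots> = (3 powr (6 / \<alpha>) * (\<delta> ^ 3 * ((21/20) / sqrt t))) powr k"
  proof -
    define A B where "A = 3 powr (6 / \<alpha>)" and "B = (21/20) / sqrt t"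
    have nonneg: "A \<ge> 0" "B \<ge> 0" using st by (simp_all add: A_def B_def)
    have "\<delta> powr (- k) * (\<delta> powr 4) powr k = \<delta> powr (3 * k)"
      by (simp add: powr_powr flip: powr_add)
    also have "\<dots> = (\<delta> ^ 3) powr k"
      using \<delta>0 by (simp add: powr_powr flip: powr_numeral)
    finally have key: "\<delta> powr (- k) * (\<delta> powr 4) powr k = (\<delta> ^ 3) powr k" .
    have "(A * (\<delta> ^ 3 * B)) powr k = A powr k * ((\<delta> ^ 3) powr k * B powr k)"
      using nonneg \<delta>0 by (simp add: powr_mult)
    then show ?thesis
      unfolding A_def[symmetric] B_def[symmetric] by (simp only: key[symmetric] mult_ac)
  qed
  also have "\<dots> \<le> (3 * C ^ 4 * exp (1 + 9 / \<alpha>) * t) powr k"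
  proof (rule powr_mono2)
    have "\<delta> ^ 3 * ((21/20) / sqrt t) = (64 * (21/20) / (19/20)^3) * (C^3 * t)"
    proof -
      have "sqrt t ^ 3 = t * sqrt t" using t by (simp add: power3_eq_cube)
      then show ?thesis
        unfolding \<delta>(1) using st by (simp add: power_mult_distrib power_divide field_simps)
    qed
    also have "\<dots> \<le> 79 * (C^4 * t)"
      using C t power_increasing[of 3 4 C]
      by (intro mult_mono mult_right_mono) (auto simp: power_divide)
    finally have "3 powr (6 / \<alpha>) * (\<delta> ^ 3 * ((21/20) / sqrt t)) \<le> 3 powr (6 / \<alpha>) * (79 * (C^4 * t))"
      by (intro mult_left_mono) auto
    also have "\<dots> = (3 powr (6 / \<alpha>) * 79) * (C^4 * t)" by simp
    also have "\<dots> \<le> (3 * exp (1 + 9 / \<alpha>)) * (C^4 * t)"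
      using C t by (intro mult_right_mono three_powr_le \<alpha>) auto
    finally show "3 powr (6 / \<alpha>) * (\<delta> ^ 3 * ((21/20) / sqrt t)) \<le> 3 * C ^ 4 * exp (1 + 9 / \<alpha>) * t"
      by (simp add: mult_ac)
  qed (use st \<delta>0 k in auto)
  finally show ?thesis by (simp add: k_def)
qed

theorem theorem4:
  fixes M :: "'a measure" and X :: "'a \<Rightarrow> real^'d" and Xs :: "nat \<Rightarrow> 'a \<Rightarrow> real^'d"
    and C \<alpha> t :: real and n :: nat
  assumes "prob_space M"
    and "X \<in> borel_measurable M"
    and "integrable M (\<lambda>\<omega>. self_outer (X \<omega>))"
    and "(\<integral>\<omega>. self_outer (X \<omega>) \<partial>M) = mat 1"
    and "C \<ge> 1" and "0 < \<alpha>" and "\<alpha> \<le> 1"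
    and "\<And>\<theta> s. \<theta> \<in> sphere 0 1 \<Longrightarrow> s > 0 \<Longrightarrow> \<P>(\<omega> in M. \<bar>\<theta> \<bullet> X \<omega>\<bar> \<le> s) \<le> (C * s) powr \<alpha>"
    and "n \<ge> 1"
    and "prob_space.indep_vars M (\<lambda>_. borel) Xs {1..n}"
    and "\<And>i. i \<in> {1..n} \<Longrightarrow> distr M borel (Xs i) = distr M borel X"
    and "real n \<ge> 6 * real CARD('d) / \<alpha>"
    and "0 < t" and "t < 1"
  shows "\<P>(\<omega> in M. lambda_min (sample_cov Xs n \<omega>) \<le> t)
           \<le> (3 * C ^ 4 * exp (1 + 9 / \<alpha>) * t) powr (\<alpha> * real n / 6)"
proof -
  interpret prob_space M by fact
  let ?A = "{\<omega>\<in>space M. lambda_min (sample_cov Xs n \<omega>) \<le> t}"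
  let ?K = "3 * C ^ 4 * exp (1 + 9 / \<alpha>)"
  (* The measure of a set that is not an event is 0 by convention. *)
  consider "?A \<notin> events" | "?K * t \<ge> 1" | "?A \<in> events" "?K * t < 1" by fastforce
  then show ?thesis
  proof cases
    case 1
    then show ?thesis by (simp add: measure_notin_sets)
  next
    case 2
    have "prob ?A \<le> 1" by simp
    also have "\<dots> \<le> (?K * t) powr (\<alpha> * real n / 6)"
      using 2 assms by (intro ge_one_powr_ge_zero) auto
    finally show ?thesis .
  next
    case 3
    (* The radius of the perturbation is r, the small-ball scale s = 4 r is the least multiple of r
       for which the exponents add up; 19/20 is a lower bound for the norms in the shell. *)
    note [measurable] = \<open>X \<in> borel_measurable M\<close>
    define R where "R = sqrt (real CARD('d))"
    define r where "r = sqrt t"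
    define s where "s = 4 * sqrt t"
    define \<delta> where "\<delta> = C * s / (19/20)"
    define lam where "lam = (2 * \<alpha> / 3) * ln (1 / \<delta>) / (16 * t)"
    define Z where "Z i \<omega> = radial_cap R (Xs i \<omega>)" for i \<omega>
    have R: "R > 0" "R^2 = CARD('d)" by (auto simp: R_def)
    have Ct: "C^4 * t \<le> 1 / 57000"
    proof -
      have "exp 10 \<le> exp (1 + 9 / \<alpha>)" using assms by (simp add: field_simps)
      then have "19500 \<le> exp (1 + 9 / \<alpha>)" using exp_10_ge by linarith
      then have "19500 * (3 * (C^4 * t)) \<le> exp (1 + 9 / \<alpha>) * (3 * (C^4 * t))"
        using assms by (intro mult_right_mono) auto
      also have "\<dots> < 1" using 3 by (simp add: mult_ac)
      finally show ?thesis by simp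
    qed
    have t: "t \<le> 1/400"
    proof -
      have "1 * t \<le> C^4 * t"
        using assms(5,13) by (intro mult_right_mono one_le_power) auto
      then show ?thesis using Ct by linarith
    qed
    have r: "0 < r" "r^2 = t" using assms(13) by (simp_all add: r_def)
    have r_le: "r \<le> 1/20"
      unfolding r_def using assms(13) t by (intro real_le_lsqrt) (auto simp: power2_eq_square)
    have s: "s > 0" "s^2 = 16 * t" using assms by (auto simp: s_def power_mult_distrib)
    have \<delta>0: "\<delta> > 0" using s assms by (simp add: \<delta>_def)
    have \<delta>1: "\<delta> < 1"
    proof -
      have "C^2 * t \<le> C^4 * t"
        using assms by (intro mult_right_mono power_increasing) auto
      then have "\<delta>^2 < 1^2"
        using s Ct by (simp add: \<delta>_def power_divide power_mult_distrib)
      then show ?thesis using \<delta>0 by (simp add: power2_less_imp_less)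
    qed
    have lam: "lam \<ge> 0" using \<delta>0 \<delta>1 assms by (simp add: lam_def)
    have exp_lam: "exp (- (lam * s^2)) = \<delta> powr (2 * \<alpha> / 3)"
      using assms(13) \<delta>0 by (simp add: s lam_def powr_def ln_div)
    have Xs [measurable]: "Xs i \<in> borel_measurable M" if "i \<in> {1..n}" for i
      using assms(10) that unfolding indep_vars_def by simp
    have laplace: "(\<integral>\<^sup>+\<omega>. ennreal (exp (- (lam * (Z i \<omega> \<bullet> u)^2))) \<partial>M) \<le> ennreal (3 * \<delta> powr (2 * \<alpha> / 3))"
      if i: "i \<in> {1..n}" and u: "norm u \<ge> 1 - r" for i u
    proof -
      have "(\<integral>\<^sup>+\<omega>. ennreal (exp (- (lam * (Z i \<omega> \<bullet> u)^2))) \<partial>M)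
          = (\<integral>\<^sup>+x. ennreal (exp (- (lam * (radial_cap R x \<bullet> u)^2))) \<partial>distr M borel (Xs i))"
        unfolding Z_def using Xs[OF i] by (subst nn_integral_distr) auto
      also have "\<dots> = (\<integral>\<^sup>+\<omega>. ennreal (exp (- (lam * (radial_cap R (X \<omega>) \<bullet> u)^2))) \<partial>M)"
        unfolding assms(11)[OF i] by (subst nn_integral_distr) auto
      also have "\<dots> \<le> ennreal (prob {\<omega>\<in>space M. \<bar>radial_cap R (X \<omega>) \<bullet> u\<bar> \<le> s} + exp (- (lam * s^2)))"
        using lam s by (intro laplace_sq_le) auto
      also have "\<dots> \<le> ennreal (2 * \<delta> powr (2 * \<alpha> / 3) + \<delta> powr (2 * \<alpha> / 3))"
        unfolding exp_lam
      proof (intro ennreal_leI add_right_mono)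
        show "prob {\<omega>\<in>space M. \<bar>radial_cap R (X \<omega>) \<bullet> u\<bar> \<le> s} \<le> 2 * \<delta> powr (2 * \<alpha> / 3)"
          unfolding \<delta>_def
        proof (rule radial_cap_small_ball)
          show "integrable M (\<lambda>\<omega>. (norm (X \<omega>))^2)"
            by (rule expectation_norm_sq_isotropic[OF assms(3,4)])
          show "expectation (\<lambda>\<omega>. (norm (X \<omega>))^2) \<le> R^2"
            by (simp add: expectation_norm_sq_isotropic[OF assms(3,4)] R)
        qed (use assms s R r r_le u \<delta>1 in \<open>auto simp: \<delta>_def\<close>)
      qed
      finally show ?thesis by simp
    qed
    have "prob ?A \<le> exp (lam * (2 * card {1..n} * (t + r^2))) * ((1 + r) / r) ^ DIM(real^'d)
        * (3 * \<delta> powr (2 * \<alpha> / 3)) ^ card {1..n}"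
    proof (rule quadratic_form_lower_tail[where Z = Z])
      show "indep_vars (\<lambda>_. borel) Z {1..n}"
        unfolding Z_def by (intro indep_vars_compose2[OF assms(10)]) simp
      show "(norm (Z i \<omega>))^2 \<le> DIM(real^'d)" for i \<omega>
        using power_mono[OF norm_radial_cap_le[of R "Xs i \<omega>"], of 2] R by (simp add: Z_def)
      show "\<exists>v. norm v = 1 \<and> (\<Sum>i\<in>{1..n}. (Z i \<omega> \<bullet> v)^2) \<le> card {1..n} * t" if "\<omega> \<in> ?A" for \<omega>
      proof -
        from that obtain v where v: "norm v = 1" "(\<Sum>i=1..n. (Xs i \<omega> \<bullet> v)^2) \<le> real n * t"
          using sample_cov_lambda_min_witness[of Xs n \<omega> t] assms(9) by blast
        have "(\<Sum>i=1..n. (Z i \<omega> \<bullet> v)^2) \<le> (\<Sum>i=1..n. (Xs i \<omega> \<bullet> v)^2)"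
          unfolding Z_def using R by (intro sum_mono radial_cap_inner_sq_le) auto
        with v show ?thesis by (intro exI[of _ v]) auto
      qed
    qed (use r lam laplace 3 in auto)
    also have "\<dots> = exp (lam * (2 * real n * (t + t))) * ((1 + sqrt t) / sqrt t) ^ CARD('d)
        * (3 * \<delta> powr (2 * \<alpha> / 3)) ^ n"
      using r by (simp add: r_def)
    also have "\<dots> \<le> (?K * t) powr (\<alpha> * real n / 6)"
      using assms t \<delta>1 by (intro tail_constant_bound) (auto simp: lam_def \<delta>_def s_def)
    finally show ?thesis .
  qed
qed

end
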